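(* Let $T$ be a closed symmetric linear relation in a Krein space $\mathfrak H$, let $(\mathfrak L,\Gamma)$ be an isometric boundary pair for $T^+$, and let $M_{\overline\Gamma}$ be the Weyl family corresponding to the isometric boundary pair $(\mathfrak L,\overline\Gamma)$ for $T^+$. Suppose in addition that $\ker\overline\Gamma=T$ and that $n_z,n_{\overline z}<\infty$ for $z\in\Omega_\Gamma\ne\emptyset$. Then $$M_{\overline\Gamma}(z)^*=M_{\Gamma_\#}(\overline z)$$ and $M_{\overline\Gamma}(z)$ is a closed relation in $\mathfrak L$.
   Context: Linear relations: a relation from a linear space $X$ to a linear space $Y$ is a linear subset $R\subseteq X\times Y$ (a relation in $X$ if $X=Y$); operators are identified with their graphs. $\operatorname{dom}R,\operatorname{ran}R$ are the domain and range, $\ker R=\{x:(x,0)\in R\}$, $\operatorname{mul}R=\{y:(0,y)\in R\}$, $R^{-1}=\{(y,x):(x,y)\in R\}$, $R(S)=\{y:\exists x\in S,\ (x,y)\in R\}$, $\overline R$ is the closure. A subspace is a closed linear subset. For a relation $R$ in $\mathfrak H$, $R-zI=\{(f,f'-zf):(f,f')\in R\}$, and $zI=\{(f,zf):f\in\mathfrak H\}$. $\mathbb C_*=\mathbb C\setminus\mathbb R$. Krein space: a Hilbert space $(\mathfrak H,\langle\cdot,\cdot\rangle)$ with a fundamental symmetry $J=J^*=J^{-1}$ and indefinite metric $[f,g]=\langle f,Jg\rangle$. The adjoint of a relation $T$ in $\mathfrak H$ is $T^+=\{(g,g')\in\mathfrak H^2:[f',g]=[f,g']\ \forall(f,f')\in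 T\}$; $T$ is symmetric if $T\subseteq T^+$. $^*$ denotes the Hilbert space adjoint of a relation. Boundary pairs: $\mathfrak L$ is a Hilbert space; $\mathfrak H^2$ and $\mathfrak L^2$ carry the fundamental symmetries $\widehat J_{\mathfrak H}=\begin{pmatrix}0&-iJ\\ iJ&0\end{pmatrix}$ and $\widehat J^\circ_{\mathfrak L}=\begin{pmatrix}0&-iI\\ iI&0\end{pmatrix}$. For a relation $\Gamma\subseteq\mathfrak H^2\times\mathfrak L^2$ put $\Gamma^+=\widehat J_{\mathfrak H}\Gamma^*\widehat J^\circ_{\mathfrak L}$, with $\Gamma^*$ the Hilbert space adjoint, and $\Gamma_\#=(\Gamma^+)^{-1}\subseteq\mathfrak H^2\times\mathfrak L^2$. $\Gamma$ is isometric if $\Gamma\subseteq\Gamma_\#$. For a closed symmetric relation $T$, $(\mathfrak L,\Gamma)$ is an isometric boundary pair for $T^+$ if $\Gamma$ is isometric and $T=\ker\Gamma_\#$. Then $(\mathfrak L,\overline\Gamma)$ is also an isometric boundary pair for $T^+$. For any relation $\Gamma\subseteq\mathfrak H^2\times\mathfrak L^2$ put $M_\Gamma(z)=\Gamma(zI)=\{\widehat l\in\mathfrak L^2:\exists f\in\mathfrak H,\ ((f,zf),\widehat l)\in\Gamma\}$ for $z\in\mathbb C_*$, a relation in $\mathfrak L$. If $(\mathfrak L,\Gamma)$ is an isometric boundary pair this is its Weyl family; $M_{\overline\Gamma}$ and $M_{\Gamma_\#}$ are defined by the same formula. With $S:=\ker\overline\Gamma$, put $\Omega_\Gamma=\{z\in\mathbb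 C_*:\operatorname{ran}(T-\overline zI)\text{ and }\operatorname{ran}(S-zI)\text{ are subspaces}\}$. For $z\in\mathbb C_*$, $n_z=\dim\ker(T^*-\overline zI)=\dim\ker(T^+-\overline zI)$. *)

theory Defs
  imports "HOL-Analysis.Analysis"
begin

section \<open>Complex Hilbert spaces\<close>

class scaleC =
  fixes scaleC :: "complex \<Rightarrow> 'a \<Rightarrow> 'a" (infixr \<open>*\<^sub>C\<close> 75)

class complex_vector = real_vector + scaleC +
  assumes scaleC_add_right: "a *\<^sub>C (x + y) = a *\<^sub>C x + a *\<^sub>C y"
    and scaleC_add_left: "(a + b) *\<^sub>C x = a *\<^sub>C x + b *\<^sub>C x"
    and scaleC_scaleC: "a *\<^sub>C (b *\<^sub>C x) = (a * b) *\<^sub>C x"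
    and scaleC_one: "1 *\<^sub>C x = x"
    and scaleR_scaleC: "r *\<^sub>R x = complex_of_real r *\<^sub>C x"

global_interpretation complex_vector:
  vector_space "scaleC :: complex \<Rightarrow> 'a \<Rightarrow> 'a :: complex_vector"
  defines csubspace = complex_vector.subspace
    and cspan = complex_vector.span
  by unfold_locales
    (simp_all add: scaleC_add_right scaleC_add_left scaleC_scaleC scaleC_one)

text \<open>The inner product is conjugate-linear in its first argument.  Symmetry, positivity and
  definiteness of the norm square all come from the last two axioms together with the norm
  axioms of \<^class>\<open>real_normed_vector\<close>.\<close>

class complex_inner = complex_vector + real_normed_vector +
  fixes cinner :: "'a \<Rightarrow> 'a \<Rightarrow> complex"
  assumes cinner_add_left: "cinner (x + y) z = cinner x z + cinner y z"
    and cinner_scaleC_left: "cinner (a *\<^sub>C x) y = cnj a * cinner x y"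
    and cinner_commute: "cinner x y = cnj (cinner y x)"
    and cinner_self: "cinner x x = complex_of_real ((norm x)\<^sup>2)"

class complex_hilbert = complex_inner + complete_space

instantiation prod :: (complex_vector, complex_vector) complex_vector
begin

definition scaleC_prod :: "complex \<Rightarrow> 'a \<times> 'b \<Rightarrow> 'a \<times> 'b"
  where "a *\<^sub>C x = (a *\<^sub>C fst x, a *\<^sub>C snd x)"

instance
  by standard (simp_all add: scaleC_prod_def prod_eq_iff scaleR_scaleC
      scaleC_add_right scaleC_add_left scaleC_scaleC scaleC_one)

end

instantiation prod :: (complex_inner, complex_inner) complex_inner
begin

definition cinner_prod :: "'a \<times> 'b \<Rightarrow> 'a \<times> 'b \<Rightarrow> complex"
  where "cinner x y = cinner (fst x) (fst y) + cinner (snd x) (snd y)"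

instance
proof
  fix x y z :: "'a \<times> 'b" and a :: complex
  show "cinner (x + y) z = cinner x z + cinner y z"
    by (simp add: cinner_prod_def cinner_add_left)
  show "cinner (a *\<^sub>C x) y = cnj a * cinner x y"
    by (simp add: cinner_prod_def scaleC_prod_def cinner_scaleC_left distrib_left)
  show "cinner x y = cnj (cinner y x)"
    by (simp add: cinner_prod_def cinner_commute [symmetric])
  show "cinner x x = complex_of_real ((norm x)\<^sup>2)"
    by (simp add: cinner_prod_def cinner_self norm_prod_def)
qed

end

instance prod :: (complex_hilbert, complex_hilbert) complex_hilbert ..

definition closed_csubspace :: "'a::complex_inner set \<Rightarrow> bool"
  where "closed_csubspace A \<longleftrightarrow> csubspace A \<and> closed A"

text \<open>The complex dimension.  The library's \<^term>\<open>vector_space.dim\<close> takes a default value on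
  infinite-dimensional sets, hence the case distinction.\<close>

definition cdim :: "'a::complex_vector set \<Rightarrow> enat"
  where "cdim V =
    (if \<exists>B. finite B \<and> B \<subseteq> V \<and> V \<subseteq> cspan B then enat (complex_vector.dim V) else \<infinity>)"


section \<open>Linear relations\<close>

text \<open>A linear relation from \<open>'a\<close> to \<open>'b\<close> is a set \<open>R :: ('a \<times> 'b) set\<close> with \<^term>\<open>csubspace R\<close>.
  Domain, range, inverse, image and closure are \<^const>\<open>Domain\<close>, \<^const>\<open>Range\<close>, \<^const>\<open>converse\<close>,
  \<^const>\<open>Image\<close> and \<^const>\<open>closure\<close>.\<close>

definition op_graph :: "('a \<Rightarrow> 'b) \<Rightarrow> ('a \<times> 'b) set"
  where "op_graph A = {(x, A x) | x. True}"

definition rel_ker :: "('a \<times> 'b::zero) set \<Rightarrow> 'a set"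
  where "rel_ker R = {x. (x, 0) \<in> R}"

definition scalar_rel :: "complex \<Rightarrow> ('a::complex_vector \<times> 'a) set"
  where "scalar_rel z = {(f, z *\<^sub>C f) | f. True}"

definition rel_shift :: "('a::complex_vector \<times> 'a) set \<Rightarrow> complex \<Rightarrow> ('a \<times> 'a) set"
  where "rel_shift R z = {(f, f' - z *\<^sub>C f) | f f'. (f, f') \<in> R}"

definition hilbert_adj :: "('a::complex_inner \<times> 'b::complex_inner) set \<Rightarrow> ('b \<times> 'a) set"
  where "hilbert_adj R = {(g, g'). \<forall>(f, f') \<in> R. cinner f' g = cinner f g'}"


section \<open>Krein spaces\<close>

definition fundamental_symmetry :: "('h::complex_hilbert \<Rightarrow> 'h) \<Rightarrow> bool"
  where "fundamental_symmetry J \<longleftrightarrow> csubspace (op_graph J) \<and>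
    hilbert_adj (op_graph J) = op_graph J \<and> (op_graph J)\<inverse> = op_graph J"

definition krein_inner :: "('h::complex_hilbert \<Rightarrow> 'h) \<Rightarrow> 'h \<Rightarrow> 'h \<Rightarrow> complex"
  where "krein_inner J f g = cinner f (J g)"

definition krein_adj :: "('h::complex_hilbert \<Rightarrow> 'h) \<Rightarrow> ('h \<times> 'h) set \<Rightarrow> ('h \<times> 'h) set"
  where "krein_adj J T =
    {(g, g'). \<forall>(f, f') \<in> T. krein_inner J f' g = krein_inner J f g'}"

definition closed_symmetric_rel :: "('h::complex_hilbert \<Rightarrow> 'h) \<Rightarrow> ('h \<times> 'h) set \<Rightarrow> bool"
  where "closed_symmetric_rel J T \<longleftrightarrow> csubspace T \<and> closed T \<and> T \<subseteq> krein_adj J T"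

definition defect_number :: "('h::complex_hilbert \<times> 'h) set \<Rightarrow> complex \<Rightarrow> enat"
  where "defect_number T z = cdim (rel_ker (rel_shift (hilbert_adj T) (cnj z)))"


section \<open>Isometric boundary pairs and Weyl families\<close>

definition J_hat :: "('h::complex_hilbert \<Rightarrow> 'h) \<Rightarrow> 'h \<times> 'h \<Rightarrow> 'h \<times> 'h"
  where "J_hat J = (\<lambda>(f, f'). (- (\<i> *\<^sub>C J f'), \<i> *\<^sub>C J f))"

text \<open>Relational composition \<^const>\<open>relcomp\<close> applies its left factor first, so the operator
  product written right to left in the literature appears here in reverse order.\<close>

definition boundary_adj ::
  "('h::complex_hilbert \<Rightarrow> 'h) \<Rightarrow> (('h \<times> 'h) \<times> ('l::complex_hilbert \<times> 'l)) set
    \<Rightarrow> (('l \<times> 'l) \<times> ('h \<times> 'h)) set"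
  where "boundary_adj J \<Gamma> = op_graph (J_hat (\<lambda>l. l)) O hilbert_adj \<Gamma> O op_graph (J_hat J)"

definition boundary_sharp ::
  "('h::complex_hilbert \<Rightarrow> 'h) \<Rightarrow> (('h \<times> 'h) \<times> ('l::complex_hilbert \<times> 'l)) set
    \<Rightarrow> (('h \<times> 'h) \<times> ('l \<times> 'l)) set"
  where "boundary_sharp J \<Gamma> = (boundary_adj J \<Gamma>)\<inverse>"

text \<open>The boundary space is carried by the type \<open>'l\<close>; the pair is for the Krein adjoint of \<open>T\<close>.\<close>

definition isometric_boundary_pair ::
  "('h::complex_hilbert \<Rightarrow> 'h) \<Rightarrow> ('h \<times> 'h) set
    \<Rightarrow> (('h \<times> 'h) \<times> ('l::complex_hilbert \<times> 'l)) set \<Rightarrow> bool"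
  where "isometric_boundary_pair J T \<Gamma> \<longleftrightarrow>
    csubspace \<Gamma> \<and> \<Gamma> \<subseteq> boundary_sharp J \<Gamma> \<and> T = rel_ker (boundary_sharp J \<Gamma>)"

definition weyl_family ::
  "(('h::complex_hilbert \<times> 'h) \<times> ('l::complex_hilbert \<times> 'l)) set \<Rightarrow> complex \<Rightarrow> ('l \<times> 'l) set"
  where "weyl_family \<Gamma> z = \<Gamma> `` scalar_rel z"

definition Omega_set ::
  "('h::complex_hilbert \<times> 'h) set \<Rightarrow> (('h \<times> 'h) \<times> ('l::complex_hilbert \<times> 'l)) set \<Rightarrow> complex set"
  where "Omega_set T \<Gamma> = {z. z \<notin> \<real> \<and>
    closed_csubspace (Range (rel_shift T (cnj z))) \<and>
    closed_csubspace (Range (rel_shift (rel_ker (closure \<Gamma>)) z))}"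

end

theory Submission
  imports Defs
begin

text \<open>
  The functional to be represented in the inclusion \<open>M(z)\<^sup>* \<subseteq> M\<^sub>#(cnj z)\<close> sends
  \<open>f' - z f\<close> to \<open>\<langle>l', k\<rangle> - \<langle>l, k'\<rangle>\<close> for \<open>((f, f'), (l, l')) \<in> \<Gamma>\<close>.  It vanishes on
  \<open>ran (ker \<Gamma> - z)\<close>, a closed subspace of finite codimension, so it is bounded for algebraic
  reasons and has a Riesz representative \<open>h\<close>; then \<open>g = J h\<close> gives \<open>((g, cnj z g), (k, k')) \<in> \<Gamma>\<^sub>#\<close>.
  The argument applies to the closure of \<open>\<Gamma>\<close> at \<open>z\<close> and to \<open>\<Gamma>\<^sub>#\<close> at \<open>cnj z\<close>, both having
  kernel \<open>T\<close>.  As \<open>\<Gamma>\<^sub>#\<^sub>#\<close> is the closure of \<open>\<Gamma>\<close>, the second application exhibits the Weyl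
  family as an adjoint, hence as a closed relation.
\<close>

section \<open>Inner product and orthogonal projection\<close>

lemma cinner_add_right: "cinner x (y + z) = cinner x y + cinner x z"
  by (metis cinner_add_left cinner_commute complex_cnj_add)

lemma cinner_scaleC_right: "cinner x (a *\<^sub>C y) = a * cinner x y"
  by (metis cinner_commute cinner_scaleC_left complex_cnj_cnj complex_cnj_mult)

lemma cinner_zero_left [simp]: "cinner 0 x = 0"
  using cinner_add_left [of 0 0 x] by simp

lemma cinner_zero_right [simp]: "cinner x 0 = 0"
  using cinner_add_right [of x 0 0] by simp

lemma cinner_minus_left: "cinner (- x) y = - cinner x y"
  using cinner_add_left [of x "- x" y] by (simp add: eq_neg_iff_add_eq_0 add.commute)

lemma cinner_minus_right: "cinner x (- y) = - cinner x y"
  using cinner_add_right [of x y "- y"] by (simp add: eq_neg_iff_add_eq_0 add.commute)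

lemma cinner_diff_left: "cinner (x - y) z = cinner x z - cinner y z"
  using cinner_add_left [of x "- y" z] by (simp add: cinner_minus_left)

lemma cinner_diff_right: "cinner x (y - z) = cinner x y - cinner x z"
  using cinner_add_right [of x y "- z"] by (simp add: cinner_minus_right)

lemma cinner_self_eq_0_iff [simp]: "cinner x x = 0 \<longleftrightarrow> x = 0"
  by (simp add: cinner_self)

lemma cinner_eq_0_commute: "cinner x y = 0 \<longleftrightarrow> cinner y x = 0"
  by (metis cinner_commute complex_cnj_zero)

lemma norm_diff_sq:
  "(norm (x - y))\<^sup>2 = (norm x)\<^sup>2 + (norm y)\<^sup>2 - 2 * Re (cinner x y)" for x y :: "'a::complex_inner"
proof -
  have "complex_of_real ((norm (x - y))\<^sup>2) =
      cinner x x + cinner y y - (cinner x y + cnj (cinner x y))"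
    unfolding cinner_self [symmetric]
    by (simp add: cinner_diff_left cinner_diff_right cinner_commute [of y x])
  also have "\<dots> = complex_of_real ((norm x)\<^sup>2 + (norm y)\<^sup>2 - 2 * Re (cinner x y))"
    by (simp only: cinner_self complex_add_cnj of_real_add of_real_diff)
  finally show ?thesis
    by (simp only: of_real_eq_iff)
qed

text \<open>Pythagoras for removing from \<open>y\<close> its component along \<open>m\<close>.
  Nonnegativity of the left side gives Cauchy-Schwarz; the explicit decrease characterises best
  approximations.\<close>

lemma norm_diff_projection_sq:
  fixes m y :: "'a::complex_inner"
  assumes "m \<noteq> 0"
  shows "(norm (y - (cinner m y / cinner m m) *\<^sub>C m))\<^sup>2 =
    (norm y)\<^sup>2 - (cmod (cinner m y))\<^sup>2 / (norm m)\<^sup>2"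
proof -
  define t where "t = cinner m y / cinner m m"
  have nz: "cinner m m \<noteq> 0"
    using assms by simp
  have "complex_of_real ((norm (y - t *\<^sub>C m))\<^sup>2) =
      cinner y y - t * cinner y m - cnj t * (cinner m y - t * cinner m m)"
    unfolding cinner_self [symmetric]
    by (simp add: cinner_diff_left cinner_diff_right cinner_scaleC_left cinner_scaleC_right
        algebra_simps)
  also have "cinner m y - t * cinner m m = 0"
    using nz by (simp add: t_def)
  also have "t * cinner y m = complex_of_real ((cmod (cinner m y))\<^sup>2 / (norm m)\<^sup>2)"
    by (simp add: t_def cinner_commute [of y m] cinner_self complex_norm_square [symmetric])
  finally have "complex_of_real ((norm (y - t *\<^sub>C m))\<^sup>2) =
      complex_of_real ((norm y)\<^sup>2 - (cmod (cinner m y))\<^sup>2 / (norm m)\<^sup>2)"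
    by (simp add: cinner_self)
  then show ?thesis
    unfolding t_def by (simp only: of_real_eq_iff)
qed

lemma cmod_cinner_le: "cmod (cinner x y) \<le> norm x * norm y" for x y :: "'a::complex_inner"
proof (cases "x = 0")
  case False
  then have "0 \<le> (norm y)\<^sup>2 - (cmod (cinner x y))\<^sup>2 / (norm x)\<^sup>2"
    by (metis norm_diff_projection_sq zero_le_power2)
  then have "(cmod (cinner x y))\<^sup>2 \<le> (norm x * norm y)\<^sup>2"
    using False by (simp add: field_simps power_mult_distrib)
  then show ?thesis
    by (rule power2_le_imp_le) simp
qed simp

lemma norm_scaleC: "norm (a *\<^sub>C x) = cmod a * norm x" for x :: "'a::complex_inner"
proof -
  have "complex_of_real ((norm (a *\<^sub>C x))\<^sup>2) = (cnj a * a) * cinner x x"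
    unfolding cinner_self [symmetric] by (simp add: cinner_scaleC_left cinner_scaleC_right)
  also have "\<dots> = complex_of_real ((cmod a * norm x)\<^sup>2)"
    by (simp add: cinner_self complex_norm_square [symmetric] power_mult_distrib mult.commute [of "cnj a"])
  finally have "(norm (a *\<^sub>C x))\<^sup>2 = (cmod a * norm x)\<^sup>2"
    by (simp only: of_real_eq_iff)
  then show ?thesis
    by simp
qed

lemma bounded_linear_cinner_right: "bounded_linear (cinner x)" for x :: "'a::complex_inner"
  by (rule bounded_linear_intro [where K = "norm x"])
    (auto simp: cinner_add_right scaleR_scaleC cinner_scaleC_right scaleR_conv_of_real
      mult.commute [of _ "norm x"] cmod_cinner_le)

lemma bounded_linear_scaleC_right: "bounded_linear (\<lambda>x::'a::complex_inner. a *\<^sub>C x)"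
  by (rule bounded_linear_intro [where K = "cmod a"])
    (auto simp: scaleC_add_right scaleR_scaleC scaleC_scaleC norm_scaleC mult.commute)

lemma csubspace_closure:
  fixes A :: "'a::complex_inner set"
  assumes "csubspace A"
  shows "csubspace (closure A)"
proof (rule complex_vector.subspaceI)
  show "0 \<in> closure A"
    using complex_vector.subspace_0 [OF assms] closure_subset by (rule subsetD [rotated])
next
  fix x y assume "x \<in> closure A" "y \<in> closure A"
  then obtain u v where uv: "\<forall>n::nat. u n \<in> A" "u \<longlonglongrightarrow> x" "\<forall>n::nat. v n \<in> A" "v \<longlonglongrightarrow> y"
    unfolding closure_sequential by metis
  then have "\<forall>n. u n + v n \<in> A"
    using complex_vector.subspace_add [OF assms] by simp
  moreover have "(\<lambda>n. u n + v n) \<longlonglongrightarrow> x + y"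
    using uv by (intro tendsto_add)
  ultimately show "x + y \<in> closure A"
    unfolding closure_sequential by (intro exI [where x = "\<lambda>n. u n + v n"]) simp
next
  fix c x assume "x \<in> closure A"
  then obtain u where u: "\<forall>n::nat. u n \<in> A" "u \<longlonglongrightarrow> x"
    unfolding closure_sequential by metis
  then have "\<forall>n. c *\<^sub>C u n \<in> A"
    using complex_vector.subspace_scale [OF assms] by simp
  moreover have "(\<lambda>n. c *\<^sub>C u n) \<longlonglongrightarrow> c *\<^sub>C x"
    by (rule bounded_linear.tendsto [OF bounded_linear_scaleC_right u(2)])
  ultimately show "c *\<^sub>C x \<in> closure A"
    unfolding closure_sequential by (intro exI [where x = "\<lambda>n. c *\<^sub>C u n"]) simp
qed

section \<open>Orthogonal complements and the projection theorem\<close>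

definition orth :: "'a::complex_inner set \<Rightarrow> 'a set"
  where "orth A = {x. \<forall>a\<in>A. cinner a x = 0}"

text \<open>By continuity of the inner product, the vectors orthogonal to a fixed \<open>x\<close>
  form a closed set.\<close>

lemma orth_closure [simp]: "orth (closure A) = orth A"
proof
  show "orth (closure A) \<subseteq> orth A"
    using closure_subset by (auto simp: orth_def)
  have "cinner a x = 0" if x: "x \<in> orth A" and a: "a \<in> closure A" for a x
  proof -
    have "closure A \<subseteq> {a. cinner x a = 0}"
    proof (rule closure_minimal)
      show "A \<subseteq> {a. cinner x a = 0}"
        using x by (auto simp: orth_def cinner_eq_0_commute [of x])
      show "closed {a. cinner x a = 0}"
        by (intro closed_Collect_eq continuous_intros
            linear_continuous_on bounded_linear_cinner_right)
    qed
    then show ?thesis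
      using a by (auto simp: cinner_eq_0_commute [of a])
  qed
  then show "orth A \<subseteq> orth (closure A)"
    by (auto simp: orth_def)
qed

text \<open>A purely algebraic substitute for closedness: it survives adjoining one vector at a time
  without any limit argument.\<close>

definition admits_projection :: "'a::complex_inner set \<Rightarrow> bool"
  where "admits_projection N \<longleftrightarrow> (\<forall>x. \<exists>p\<in>N. x - p \<in> orth N)"

text \<open>If some \<open>m\<close> in \<open>M\<close> were not orthogonal to
  \<open>x - p\<close>, moving \<open>p\<close> along \<open>m\<close> by the optimal coefficient
  would strictly shorten the distance.\<close>

lemma minimizer_imp_orth:
  fixes x p :: "'a::complex_inner"
  assumes M: "csubspace M" and p: "p \<in> M"
    and min: "\<And>m. m \<in> M \<Longrightarrow> norm (x - p) \<le> norm (x - m)"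
  shows "x - p \<in> orth M"
proof -
  have "cinner m (x - p) = 0" if m: "m \<in> M" for m
  proof (cases "m = 0")
    case False
    define t where "t = cinner m (x - p) / cinner m m"
    have "p + t *\<^sub>C m \<in> M"
      using M p m by (simp add: complex_vector.subspace_add complex_vector.subspace_scale)
    then have "norm (x - p) \<le> norm ((x - p) - t *\<^sub>C m)"
      using min [of "p + t *\<^sub>C m"] by (simp add: diff_diff_eq)
    then have "(norm (x - p))\<^sup>2 \<le> (norm ((x - p) - t *\<^sub>C m))\<^sup>2"
      by (simp add: power_mono)
    then have "(cmod (cinner m (x - p)))\<^sup>2 / (norm m)\<^sup>2 \<le> 0"
      unfolding t_def norm_diff_projection_sq [OF False] by simp
    then show ?thesis
      using False by (simp add: divide_le_0_iff)
  qed simp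
  then show ?thesis
    by (simp add: orth_def)
qed

lemma parallelogram_law:
  "(norm (x - y))\<^sup>2 + (norm (x + y))\<^sup>2 = 2 * (norm x)\<^sup>2 + 2 * (norm y)\<^sup>2"
  for x y :: "'a::complex_inner"
  using norm_diff_sq [of x y] norm_diff_sq [of x "- y"] by (simp add: cinner_minus_right)

text \<open>The parallelogram law centred at \<open>x\<close>. Two near-minimizers must be close
  together, since their midpoint cannot beat the minimal distance.\<close>

lemma norm_midpoint_sq:
  fixes x m n :: "'a::complex_inner"
  shows "(norm (m - n))\<^sup>2 =
    2 * (norm (x - m))\<^sup>2 + 2 * (norm (x - n))\<^sup>2 - 4 * (norm (x - (1/2) *\<^sub>R (m + n)))\<^sup>2"
proof -
  have "(x - n) - (x - m) = m - n"
    by simp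
  moreover have "(x - n) + (x - m) = 2 *\<^sub>R (x - (1/2) *\<^sub>R (m + n))"
    by (simp add: scaleR_diff_right scaleR_2 algebra_simps)
  moreover have "(norm (2 *\<^sub>R (x - (1/2) *\<^sub>R (m + n))))\<^sup>2 = 4 * (norm (x - (1/2) *\<^sub>R (m + n)))\<^sup>2"
    unfolding norm_scaleR by (simp add: power_mult_distrib)
  ultimately show ?thesis
    using parallelogram_law [of "x - n" "x - m"] by simp
qed

text \<open>A minimizing sequence for the distance is Cauchy, and its limit is a best approximation
  in the closed subspace.\<close>

lemma closed_csubspace_admits_projection:
  fixes M :: "'a::complex_hilbert set"
  assumes "closed_csubspace M"
  shows "admits_projection M"
  unfolding admits_projection_def
proof
  fix x :: 'a
  have M: "csubspace M" "closed M"
    using assms by (auto simp: closed_csubspace_def)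
  have ne: "M \<noteq> {}"
    using complex_vector.subspace_0 [OF M(1)] by blast
  define d where "d = (INF m\<in>M. (norm (x - m))\<^sup>2)"
  have bdd: "bdd_below ((\<lambda>m. (norm (x - m))\<^sup>2) ` M)"
    by (rule bdd_belowI [where m = 0]) auto
  have d_le: "d \<le> (norm (x - m))\<^sup>2" if "m \<in> M" for m
    unfolding d_def by (rule cINF_lower [OF bdd that])
  have "\<exists>m\<in>M. (norm (x - m))\<^sup>2 < d + inverse (real (Suc n))" for n
    using cINF_less_iff [OF ne bdd, of "d + inverse (real (Suc n))"] unfolding d_def by simp
  then obtain u where uM: "\<And>n. u n \<in> M"
    and u: "\<And>n. (norm (x - u n))\<^sup>2 < d + inverse (real (Suc n))"
    by metis
  have half: "(1/2) *\<^sub>R (m + n) \<in> M" if "m \<in> M" "n \<in> M" for m n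
    using that M(1)
    by (simp only: scaleR_scaleC complex_vector.subspace_add complex_vector.subspace_scale)
  \<comment> \<open>The midpoint lies in \<open>M\<close>, so its squared distance is at least
    \<open>d\<close>; the contributions \<open>4 * d\<close> cancel.\<close>
  have dist: "(norm (u n - u k))\<^sup>2 < 2 * inverse (real (Suc n)) + 2 * inverse (real (Suc k))" for n k
    using norm_midpoint_sq [of "u n" "u k" x] u [of n] u [of k] d_le [OF half [OF uM [of n] uM [of k]]]
    by linarith
  have "Cauchy u"
  proof (rule metric_CauchyI)
    fix e :: real assume e: "0 < e"
    obtain N where N: "inverse (real (Suc N)) < e\<^sup>2 / 4"
      using reals_Archimedean [of "e\<^sup>2 / 4"] e by auto
    have "dist (u n) (u k) < e" if "n \<ge> N" "k \<ge> N" for n k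
    proof -
      have "inverse (real (Suc n)) \<le> inverse (real (Suc N))"
        "inverse (real (Suc k)) \<le> inverse (real (Suc N))"
        using that by (intro le_imp_inverse_le; simp)+
      then have "(norm (u n - u k))\<^sup>2 < e\<^sup>2"
        using dist [of n k] N by linarith
      then show ?thesis
        using e unfolding dist_norm by (auto intro: power2_less_imp_less)
    qed
    then show "\<exists>N. \<forall>n\<ge>N. \<forall>k\<ge>N. dist (u n) (u k) < e"
      by blast
  qed
  then have "convergent u"
    by (rule Cauchy_convergent)
  then obtain p where p: "u \<longlonglongrightarrow> p"
    unfolding convergent_def ..
  have pM: "p \<in> M"
    by (rule closed_sequentially [OF M(2) _ p]) (rule uM)
  have dlim: "(\<lambda>n. d + inverse (real (Suc n))) \<longlonglongrightarrow> d + 0"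
    by (intro tendsto_add tendsto_const LIMSEQ_inverse_real_of_nat)
  have normlim: "(\<lambda>n. (norm (x - u n))\<^sup>2) \<longlonglongrightarrow> (norm (x - p))\<^sup>2"
    by (intro tendsto_intros p)
  have le: "(norm (x - p))\<^sup>2 \<le> d + 0"
    by (rule LIMSEQ_le [OF normlim dlim], intro exI allI impI less_imp_le [OF u])
  have "norm (x - p) \<le> norm (x - m)" if "m \<in> M" for m
    by (rule power2_le_imp_le [OF _ norm_ge_zero]) (use le d_le [OF that] in linarith)
  then have "x - p \<in> orth M"
    using minimizer_imp_orth [OF M(1) pM] by blast
  then show "\<exists>p\<in>M. x - p \<in> orth M"
    using pM by blast
qed

text \<open>For \<open>x\<close> in the double complement, the residual of its projection onto the
  closure is orthogonal to both \<open>x\<close> and the projection, hence to itself.\<close>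

lemma orth_orth:
  fixes A :: "'a::complex_hilbert set"
  assumes "csubspace A"
  shows "orth (orth A) = closure A"
proof
  have "closure A \<subseteq> orth (orth (closure A))"
    unfolding orth_def using cinner_eq_0_commute by blast
  then show "closure A \<subseteq> orth (orth A)"
    by simp
next
  show "orth (orth A) \<subseteq> closure A"
  proof
    fix x assume x: "x \<in> orth (orth A)"
    have "closed_csubspace (closure A)"
      using csubspace_closure [OF assms] by (simp add: closed_csubspace_def)
    then obtain p where p: "p \<in> closure A" "x - p \<in> orth (closure A)"
      using closed_csubspace_admits_projection by (metis admits_projection_def)
    then have "cinner (x - p) p = 0"
      unfolding cinner_eq_0_commute [of "x - p"] orth_def by blast
    moreover have "cinner (x - p) x = 0"
      using x p(2) by (simp add: orth_def [of "orth A"])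
    ultimately have "cinner (x - p) (x - p) = 0"
      by (simp add: cinner_diff_right)
    then show "x \<in> closure A"
      using p(1) by simp
  qed
qed

section \<open>Functionals vanishing on a subspace of finite codimension\<close>

text \<open>One Gram-Schmidt step: \<open>b\<close> is replaced by its residual \<open>b'\<close>,
  and the projection gains the component of \<open>x\<close> along \<open>b'\<close>.\<close>

lemma admits_projection_cspan_insert:
  fixes A :: "'a::complex_inner set"
  assumes "admits_projection (cspan A)"
  shows "admits_projection (cspan (insert b A))"
  unfolding admits_projection_def
proof
  fix x :: 'a
  obtain q where q: "q \<in> cspan A" "b - q \<in> orth (cspan A)"
    using assms by (auto simp: admits_projection_def)
  obtain p where p: "p \<in> cspan A" "x - p \<in> orth (cspan A)"
    using assms by (auto simp: admits_projection_def)
  define b' where "b' = b - q"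
  \<comment> \<open>If \<open>b\<close> already lies in the span, then \<open>b' = 0\<close> and
    division by zero gives \<open>t = 0\<close>, so no case distinction is needed.\<close>
  define t where "t = cinner b' x / cinner b' b'"
  have sub: "cspan A \<subseteq> cspan (insert b A)"
    by (intro complex_vector.span_mono subset_insertI)
  have "b' \<in> cspan (insert b A)"
    unfolding b'_def
    by (rule complex_vector.span_diff [OF complex_vector.span_base subsetD [OF sub q(1)]]) simp
  then have mem: "p + t *\<^sub>C b' \<in> cspan (insert b A)"
    using sub p(1) by (intro complex_vector.span_add complex_vector.span_scale) auto
  have A: "cinner a (x - (p + t *\<^sub>C b')) = 0" if "a \<in> cspan A" for a
    using q(2) p(2) that
    by (auto simp: orth_def b'_def [symmetric] cinner_add_right cinner_diff_right cinner_scaleC_right)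
  have "cinner b' p = 0"
    using q(2) p(1) by (auto simp: orth_def b'_def [symmetric] cinner_eq_0_commute [of _ p])
  then have b': "cinner b' (x - (p + t *\<^sub>C b')) = 0"
    by (simp add: cinner_add_right cinner_diff_right cinner_scaleC_right t_def)
  have "cinner y (x - (p + t *\<^sub>C b')) = 0" if y: "y \<in> cspan (insert b A)" for y
  proof -
    obtain k where "y - k *\<^sub>C b \<in> cspan A"
      using y complex_vector.span_breakdown_eq by blast
    \<comment> \<open>Since \<open>b = q + b'\<close>, this is the part of \<open>y\<close> in the
      old span; what remains is \<open>k *\<^sub>C b'\<close>.\<close>
    then have "(y - k *\<^sub>C b) + k *\<^sub>C q \<in> cspan A"
      using q(1) by (intro complex_vector.span_add complex_vector.span_scale)
    from A [OF this] have "cinner (((y - k *\<^sub>C b) + k *\<^sub>C q) + k *\<^sub>C b') (x - (p + t *\<^sub>C b')) = 0"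
      by (simp only: cinner_add_left [of _ "k *\<^sub>C b'"] cinner_scaleC_left b') simp
    moreover have "((y - k *\<^sub>C b) + k *\<^sub>C q) + k *\<^sub>C b' = y"
      by (simp add: b'_def complex_vector.scale_right_diff_distrib)
    ultimately show ?thesis
      by simp
  qed
  then have "x - (p + t *\<^sub>C b') \<in> orth (cspan (insert b A))"
    by (simp add: orth_def)
  then show "\<exists>p\<in>cspan (insert b A). x - p \<in> orth (cspan (insert b A))"
    using mem by blast
qed

text \<open>\<open>N\<close> is spanned by \<open>R\<close> and a basis of
  \<open>N \<inter> orth R\<close>. That basis is finite, being independent inside
  \<open>cspan B\<close>, so finitely many Gram-Schmidt steps lead from \<open>R\<close> to
  \<open>N\<close>.\<close>

lemma admits_projection_finite_codim:
  fixes R N B :: "'a::complex_hilbert set"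
  assumes R: "closed_csubspace R" and N: "csubspace N" and RN: "R \<subseteq> N"
    and B: "finite B" "orth R \<subseteq> cspan B"
  shows "admits_projection N"
proof -
  have R': "csubspace R"
    using R by (simp add: closed_csubspace_def)
  obtain C where C: "C \<subseteq> N \<inter> orth R" "complex_vector.independent C" "N \<inter> orth R \<subseteq> cspan C"
    using complex_vector.maximal_independent_subset by blast
  have "finite C"
    using complex_vector.independent_span_bound [OF B(1) C(2)] C(1) B(2) by blast
  then have "admits_projection (cspan (C \<union> R))"
  proof induction
    case empty
    have "cspan R = R"
      using R' by (simp add: complex_vector.span_eq_iff)
    then show ?case
      using closed_csubspace_admits_projection [OF R] by (simp only: Un_empty_left)
  next
    case (insert b C)
    then show ?case
      by (simp add: admits_projection_cspan_insert)
  qed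
  moreover have "cspan (C \<union> R) = N"
  proof
    show "cspan (C \<union> R) \<subseteq> N"
      using C(1) RN N by (intro complex_vector.span_minimal) auto
    show "N \<subseteq> cspan (C \<union> R)"
    proof
      fix x assume x: "x \<in> N"
      obtain p where p: "p \<in> R" "x - p \<in> orth R"
        using closed_csubspace_admits_projection [OF R] by (auto simp: admits_projection_def)
      then have "x - p \<in> N \<inter> orth R"
        using x RN N complex_vector.subspace_diff by blast
      then have "x - p \<in> cspan (C \<union> R)"
        using C(3) complex_vector.span_mono [of C "C \<union> R"] by blast
      moreover have "p \<in> cspan (C \<union> R)"
        using p(1) by (intro complex_vector.span_base) auto
      ultimately show "x \<in> cspan (C \<union> R)"
        using complex_vector.span_add by fastforce
    qed
  qed
  ultimately show ?thesis
    by simp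
qed

lemma riesz_finite_codim:
  fixes G :: "'g::complex_vector set" and \<alpha> :: "'g \<Rightarrow> 'a::complex_hilbert"
    and \<phi> :: "'g \<Rightarrow> complex"
  assumes G: "csubspace G"
    and \<alpha>: "\<And>x y. \<alpha> (x + y) = \<alpha> x + \<alpha> y" "\<And>c x. \<alpha> (c *\<^sub>C x) = c *\<^sub>C \<alpha> x"
    and \<phi>: "\<And>x y. \<phi> (x + y) = \<phi> x + \<phi> y" "\<And>c x. \<phi> (c *\<^sub>C x) = cnj c * \<phi> x"
    and ker: "\<And>x. x \<in> G \<Longrightarrow> \<alpha> x = 0 \<Longrightarrow> \<phi> x = 0"
    and R: "closed_csubspace R" "R \<subseteq> \<alpha> ` {x \<in> G. \<phi> x = 0}"
    and B: "finite B" "orth R \<subseteq> cspan B"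
  shows "\<exists>h. \<forall>x\<in>G. cinner (\<alpha> x) h = \<phi> x"
proof (cases "\<forall>x\<in>G. \<phi> x = 0")
  case True
  then show ?thesis
    by (intro exI [where x = 0]) simp
next
  case False
  then obtain x0 where x0: "x0 \<in> G" "\<phi> x0 \<noteq> 0"
    by blast
  define N where "N = \<alpha> ` {x \<in> G. \<phi> x = 0}"
  have zero: "\<alpha> 0 = 0" "\<phi> 0 = 0"
    using \<alpha>(1) [of 0 0] \<phi>(1) [of 0 0] by auto
  have diff: "\<alpha> (x - y) = \<alpha> x - \<alpha> y" "\<phi> (x - y) = \<phi> x - \<phi> y" for x y
    using \<alpha>(1) [of "x - y" y] \<phi>(1) [of "x - y" y] by auto
  have "csubspace N"
  proof (rule complex_vector.subspaceI)
    show "0 \<in> N"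
      using complex_vector.subspace_0 [OF G] zero unfolding N_def by force
    show "x + y \<in> N" if "x \<in> N" "y \<in> N" for x y
      using that complex_vector.subspace_add [OF G] unfolding N_def
      by (auto simp: \<alpha>(1) [symmetric] \<phi>(1) intro!: imageI)
    show "c *\<^sub>C x \<in> N" if "x \<in> N" for c x
      using that complex_vector.subspace_scale [OF G] unfolding N_def
      by (auto simp: \<alpha>(2) [symmetric] \<phi>(2) intro!: imageI)
  qed
  then have "admits_projection N"
    using admits_projection_finite_codim R B unfolding N_def by blast
  then obtain p where "p \<in> N" "\<alpha> x0 - p \<in> orth N"
    by (auto simp: admits_projection_def)
  then obtain y where y: "y \<in> G" "\<phi> y = 0" "\<alpha> x0 - \<alpha> y \<in> orth N"
    unfolding N_def by blast
  \<comment> \<open>Subtracting \<open>y\<close> makes the image orthogonal to \<open>N\<close>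
    without changing the value of \<open>\<phi>\<close>.\<close>
  define x1 where "x1 = x0 - y"
  have x1: "x1 \<in> G" "\<phi> x1 \<noteq> 0" "\<alpha> x1 \<in> orth N"
    using x0 y complex_vector.subspace_diff [OF G] by (auto simp: x1_def diff)
  have nz: "cinner (\<alpha> x1) (\<alpha> x1) \<noteq> 0"
    using ker x1 by auto
  define h where "h = (\<phi> x1 / cinner (\<alpha> x1) (\<alpha> x1)) *\<^sub>C \<alpha> x1"
  have "cinner (\<alpha> x) h = \<phi> x" if x: "x \<in> G" for x
  proof -
    \<comment> \<open>This coefficient puts \<open>x - c *\<^sub>C x1\<close> into the kernel of
      \<open>\<phi>\<close>; the conjugate undoes the one in \<open>\<phi>(2)\<close>.\<close>
    define c where "c = cnj (\<phi> x / \<phi> x1)"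
    have "x - c *\<^sub>C x1 \<in> G"
      using G x x1(1) by (simp add: complex_vector.subspace_diff complex_vector.subspace_scale)
    moreover have "\<phi> (x - c *\<^sub>C x1) = 0"
      using x1(2) by (simp add: diff \<phi>(2) c_def)
    ultimately have "cinner (\<alpha> (x - c *\<^sub>C x1)) (\<alpha> x1) = 0"
      using x1(3) unfolding orth_def N_def by blast
    then have "cinner (\<alpha> x) (\<alpha> x1) = \<phi> x / \<phi> x1 * cinner (\<alpha> x1) (\<alpha> x1)"
      by (simp add: diff \<alpha>(2) cinner_diff_left cinner_scaleC_left c_def)
    then show ?thesis
      using nz x1(2) by (simp add: h_def cinner_scaleC_right)
  qed
  then show ?thesis
    by blast
qed

section \<open>Adjoints and Weyl families\<close>

text \<open>An adjoint is an intersection of zero sets of continuous linear functionals, one for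
  each element of \<open>R\<close>.\<close>

lemma closed_csubspace_hilbert_adj: "closed_csubspace (hilbert_adj R)"
proof -
  have eq: "hilbert_adj R = (\<Inter>x\<in>R. {y. cinner (snd x) (fst y) = cinner (fst x) (snd y)})"
    by (fastforce simp: hilbert_adj_def)
  have "csubspace (hilbert_adj R)"
    unfolding eq
    by (rule complex_vector.subspaceI)
      (auto simp: cinner_add_right cinner_scaleC_right scaleC_prod_def)
  moreover have "closed (hilbert_adj R)"
    unfolding eq
    by (intro closed_INT ballI closed_Collect_eq continuous_intros
        bounded_linear.continuous_on [OF bounded_linear_cinner_right])
  ultimately show ?thesis
    by (simp add: closed_csubspace_def)
qed

text \<open>Converts the defect number into the dimension of the complement of a range, the form in
  which finite codimension is used.\<close>

lemma ker_shift_hilbert_adj: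
  "rel_ker (rel_shift (hilbert_adj T) (cnj z)) = orth (Range (rel_shift T z))"
proof (rule set_eqI)
  fix g
  have "g \<in> rel_ker (rel_shift (hilbert_adj T) (cnj z)) \<longleftrightarrow>
      (\<forall>(f, f')\<in>T. cinner f' g = cinner f (cnj z *\<^sub>C g))"
    by (auto simp: rel_ker_def rel_shift_def hilbert_adj_def)
  also have "\<dots> \<longleftrightarrow> (\<forall>(f, f')\<in>T. cinner (f' - z *\<^sub>C f) g = 0)"
    by (simp add: cinner_diff_left cinner_scaleC_left cinner_scaleC_right)
  also have "\<dots> \<longleftrightarrow> g \<in> orth (Range (rel_shift T z))"
    by (force simp: orth_def rel_shift_def)
  finally show "g \<in> rel_ker (rel_shift (hilbert_adj T) (cnj z)) \<longleftrightarrow> \<dots>" .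
qed

lemma defect_number_finiteE:
  assumes "defect_number T z < \<infinity>"
  obtains B where "finite B" "orth (Range (rel_shift T z)) \<subseteq> cspan B"
  using assms unfolding defect_number_def cdim_def ker_shift_hilbert_adj
  by (auto split: if_splits)

section \<open>Fundamental symmetries and the Green identity\<close>

lemma op_graph_iff: "(x, y) \<in> op_graph A \<longleftrightarrow> y = A x"
  by (auto simp: op_graph_def)

lemma fundamental_symmetry_linear:
  assumes "fundamental_symmetry J"
  shows "J (x + y) = J x + J y" and "J (a *\<^sub>C x) = a *\<^sub>C J x"
proof -
  have lin: "csubspace (op_graph J)"
    using assms by (simp add: fundamental_symmetry_def)
  have "(x, J x) + (y, J y) \<in> op_graph J" "a *\<^sub>C (x, J x) \<in> op_graph J"
    by (intro complex_vector.subspace_add [OF lin] complex_vector.subspace_scale [OF lin];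
        auto simp: op_graph_def)+
  then show "J (x + y) = J x + J y" and "J (a *\<^sub>C x) = a *\<^sub>C J x"
    by (auto simp: op_graph_def scaleC_prod_def)
qed

lemma fundamental_symmetry_involution:
  assumes "fundamental_symmetry J"
  shows "J (J x) = x"
proof -
  have "(op_graph J)\<inverse> = op_graph J"
    using assms by (simp add: fundamental_symmetry_def)
  moreover have "(J x, x) \<in> (op_graph J)\<inverse>"
    by (auto simp: op_graph_def)
  ultimately have "(J x, x) \<in> op_graph J"
    by blast
  then show ?thesis
    by (auto simp: op_graph_def)
qed

lemma fundamental_symmetry_selfadjoint:
  assumes "fundamental_symmetry J"
  shows "cinner (J x) y = cinner x (J y)"
proof -
  have "(y, J y) \<in> hilbert_adj (op_graph J)"
    using assms by (auto simp: fundamental_symmetry_def op_graph_def)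
  then show ?thesis
    by (auto simp: hilbert_adj_def op_graph_def)
qed

text \<open>The Gram operator of the indefinite form on the product of \<open>'h \<times> 'h\<close>
  and \<open>'l \<times> 'l\<close> whose vanishing is the abstract Green identity. The minus sign
  on the boundary component makes that identity an orthogonality relation.\<close>

definition green_map ::
  "('h::complex_hilbert \<Rightarrow> 'h) \<Rightarrow> ('h \<times> 'h) \<times> ('l::complex_hilbert \<times> 'l)
    \<Rightarrow> ('h \<times> 'h) \<times> ('l \<times> 'l)"
  where "green_map J = (\<lambda>(f, l). (J_hat J f, - J_hat (\<lambda>l. l) l))"

context
  fixes J :: "'h::complex_hilbert \<Rightarrow> 'h"
  assumes J: "fundamental_symmetry J"
begin

lemma J_minus: "J (- x) = - J x"
  using fundamental_symmetry_linear(2) [OF J, of "- 1" x]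
  by (simp add: complex_vector.scale_minus_left scaleC_one)

lemma J_hat_involution: "J_hat J (J_hat J x) = x"
  by (cases x) (simp add: J_hat_def fundamental_symmetry_linear(2) [OF J] J_minus
      fundamental_symmetry_involution [OF J] scaleC_scaleC scaleC_one)

lemma green_map_involution: "green_map J (green_map J x) = x"
  by (cases x) (simp add: green_map_def J_hat_involution, simp add: J_hat_def split_beta
      prod_eq_iff scaleC_scaleC scaleC_one)

lemma green_map_selfadjoint: "cinner (green_map J x) y = cinner x (green_map J y)"
  by (simp add: green_map_def J_hat_def split_beta cinner_prod_def cinner_minus_left
      cinner_minus_right cinner_scaleC_left cinner_scaleC_right
      fundamental_symmetry_selfadjoint [OF J])

lemma cinner_green_map:
  "cinner ((f, f'), (l, l')) (green_map J ((g, g'), (k, k'))) =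
    \<i> * ((cinner f' (J g) - cinner f (J g')) - (cinner l' k - cinner l k'))"
  by (simp add: green_map_def J_hat_def cinner_prod_def cinner_minus_right cinner_scaleC_right
      algebra_simps)

text \<open>Unwinding the compositions and inverse shows that
  \<open>boundary_sharp J \<Gamma>\<close> is the orthogonal complement of \<open>\<Gamma>\<close>
  in the indefinite form. Its duality properties then reduce to those of
  \<open>orth\<close>.\<close>

lemma boundary_sharp_iff: "x \<in> boundary_sharp J \<Gamma> \<longleftrightarrow> green_map J x \<in> orth \<Gamma>"
proof -
  obtain f l where x: "x = (f, l)"
    by (cases x)
  have "x \<in> boundary_sharp J \<Gamma> \<longleftrightarrow>
      (\<exists>w. (J_hat (\<lambda>l. l) l, w) \<in> hilbert_adj \<Gamma> \<and> f = J_hat J w)"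
    by (simp add: x boundary_sharp_def boundary_adj_def relcomp_unfold op_graph_iff
        del: split_paired_Ex)
  \<comment> \<open>As \<open>J_hat J\<close> is an involution, the only possible \<open>w\<close>
    is \<open>J_hat J f\<close>.\<close>
  also have "\<dots> \<longleftrightarrow> (J_hat (\<lambda>l. l) l, J_hat J f) \<in> hilbert_adj \<Gamma>"
    using J_hat_involution by metis
  also have "\<dots> \<longleftrightarrow> green_map J x \<in> orth \<Gamma>"
  proof -
    have "cinner y (green_map J x) =
        cinner (fst y) (J_hat J f) - cinner (snd y) (J_hat (\<lambda>l. l) l)" for y
      by (subst cinner_prod_def) (simp add: x green_map_def cinner_minus_right)
    then show ?thesis
      by (auto simp: hilbert_adj_def orth_def)
  qed
  finally show ?thesis .
qed

lemma boundary_sharp_iff_green: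
  "((g, g'), (k, k')) \<in> boundary_sharp J \<Gamma> \<longleftrightarrow>
    (\<forall>f f' l l'. ((f, f'), (l, l')) \<in> \<Gamma> \<longrightarrow>
      cinner f' (J g) - cinner f (J g') = cinner l' k - cinner l k')"
  unfolding boundary_sharp_iff orth_def
  by (force simp: cinner_green_map)

lemma csubspace_boundary_sharp: "csubspace (boundary_sharp J \<Gamma>)"
proof (rule complex_vector.subspaceI)
  have self: "x \<in> boundary_sharp J \<Gamma> \<longleftrightarrow> (\<forall>y\<in>\<Gamma>. cinner (green_map J y) x = 0)" for x
    by (simp add: boundary_sharp_iff orth_def green_map_selfadjoint)
  show "0 \<in> boundary_sharp J \<Gamma>"
    by (simp add: self)
  show "x + y \<in> boundary_sharp J \<Gamma>" if "x \<in> boundary_sharp J \<Gamma>" "y \<in> boundary_sharp J \<Gamma>" for x y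
    using that by (simp add: self cinner_add_right)
  show "c *\<^sub>C x \<in> boundary_sharp J \<Gamma>" if "x \<in> boundary_sharp J \<Gamma>" for c x
    using that by (simp add: self cinner_scaleC_right)
qed

lemma boundary_sharp_closure: "boundary_sharp J (closure \<Gamma>) = boundary_sharp J \<Gamma>"
  by (rule set_eqI) (simp add: boundary_sharp_iff)

text \<open>\<open>green_map J\<close> is selfadjoint and involutive, so its two occurrences cancel
  and the ordinary double complement remains.\<close>

lemma boundary_sharp_sharp:
  assumes "csubspace \<Gamma>"
  shows "boundary_sharp J (boundary_sharp J \<Gamma>) = closure \<Gamma>"
proof (rule set_eqI)
  fix x
  have "x \<in> boundary_sharp J (boundary_sharp J \<Gamma>) \<longleftrightarrow>
      (\<forall>y. green_map J y \<in> orth \<Gamma> \<longrightarrow> cinner (green_map J y) x = 0)"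
    by (auto simp: boundary_sharp_iff [of x] orth_def [of "boundary_sharp J \<Gamma>"]
        boundary_sharp_iff [of _ \<Gamma>] green_map_selfadjoint)
  also have "\<dots> \<longleftrightarrow> (\<forall>w\<in>orth \<Gamma>. cinner w x = 0)"
    by (metis green_map_involution)
  also have "\<dots> \<longleftrightarrow> x \<in> closure \<Gamma>"
    by (simp add: orth_orth [OF assms, symmetric] orth_def [of "orth \<Gamma>"])
  finally show "x \<in> boundary_sharp J (boundary_sharp J \<Gamma>) \<longleftrightarrow> x \<in> closure \<Gamma>" .
qed

text \<open>Stated for a general linear \<open>\<Gamma>\<close> so that it serves both
  \<open>closure \<Gamma>\<close> and \<open>boundary_sharp J \<Gamma>\<close>. One inclusion is the
  Green identity; the other is the Riesz argument.\<close>

lemma hilbert_adj_weyl_family: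
  fixes \<Gamma> :: "(('h \<times> 'h) \<times> ('l::complex_hilbert \<times> 'l)) set"
  assumes \<Gamma>: "csubspace \<Gamma>"
    and R: "closed_csubspace (Range (rel_shift (rel_ker \<Gamma>) z))"
    and defect: "defect_number (rel_ker \<Gamma>) z < \<infinity>"
  shows "hilbert_adj (weyl_family \<Gamma> z) = weyl_family (boundary_sharp J \<Gamma>) (cnj z)"
proof
  have weyl: "(k, k') \<in> weyl_family \<Delta> w \<longleftrightarrow> (\<exists>g. ((g, w *\<^sub>C g), (k, k')) \<in> \<Delta>)"
    for k k' w and \<Delta> :: "(('h \<times> 'h) \<times> ('l \<times> 'l)) set"
    by (auto simp: weyl_family_def scalar_rel_def)
  \<comment> \<open>At \<open>(f, z *\<^sub>C f)\<close> and \<open>(g, cnj z *\<^sub>C g)\<close>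
    the two Krein space terms of the Green identity cancel.\<close>
  have "(k, k') \<in> hilbert_adj (weyl_family \<Gamma> z)"
    if "((g, cnj z *\<^sub>C g), (k, k')) \<in> boundary_sharp J \<Gamma>" for g k k'
    using that unfolding boundary_sharp_iff_green
    by (force simp: hilbert_adj_def weyl fundamental_symmetry_linear(2) [OF J]
        cinner_scaleC_left cinner_scaleC_right)
  then show "weyl_family (boundary_sharp J \<Gamma>) (cnj z) \<subseteq> hilbert_adj (weyl_family \<Gamma> z)"
    by (auto simp: weyl)
  have "\<exists>g. ((g, cnj z *\<^sub>C g), (k, k')) \<in> boundary_sharp J \<Gamma>"
    if kk: "(k, k') \<in> hilbert_adj (weyl_family \<Gamma> z)" for k k'
  proof -
    define \<alpha> where "\<alpha> = (\<lambda>x :: ('h \<times> 'h) \<times> ('l \<times> 'l). snd (fst x) - z *\<^sub>C fst (fst x))"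
    define \<phi> where
      "\<phi> = (\<lambda>x :: ('h \<times> 'h) \<times> ('l \<times> 'l). cinner (snd (snd x)) k - cinner (fst (snd x)) k')"
    obtain B where B: "finite B" "orth (Range (rel_shift (rel_ker \<Gamma>) z)) \<subseteq> cspan B"
      using defect by (rule defect_number_finiteE)
    have "\<exists>h. \<forall>x\<in>\<Gamma>. cinner (\<alpha> x) h = \<phi> x"
    proof (rule riesz_finite_codim [OF \<Gamma> _ _ _ _ _ R _ B])
      show "\<alpha> (x + y) = \<alpha> x + \<alpha> y" for x y
        by (simp add: \<alpha>_def scaleC_add_right)
      show "\<alpha> (c *\<^sub>C x) = c *\<^sub>C \<alpha> x" for c x
        by (simp add: \<alpha>_def scaleC_prod_def complex_vector.scale_right_diff_distrib
            scaleC_scaleC mult.commute)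
      show "\<phi> (x + y) = \<phi> x + \<phi> y" for x y
        by (simp add: \<phi>_def cinner_add_left)
      show "\<phi> (c *\<^sub>C x) = cnj c * \<phi> x" for c x
        by (simp add: \<phi>_def scaleC_prod_def cinner_scaleC_left right_diff_distrib)
      \<comment> \<open>If \<open>\<alpha> x = 0\<close>, then \<open>f' = z *\<^sub>C f\<close>, so
        the boundary values lie in the Weyl family, where the adjoint relation gives
        \<open>\<phi> x = 0\<close>.\<close>
      show "\<phi> x = 0" if x: "x \<in> \<Gamma>" "\<alpha> x = 0" for x
      proof -
        obtain f f' l l' where x': "x = ((f, f'), (l, l'))"
          by (metis surj_pair)
        then have "(l, l') \<in> weyl_family \<Gamma> z"
          using x by (auto simp: \<alpha>_def weyl)
        then show ?thesis
          using kk by (auto simp: \<phi>_def x' hilbert_adj_def)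
      qed
      have "f' - z *\<^sub>C f \<in> \<alpha> ` {x \<in> \<Gamma>. \<phi> x = 0}" if "((f, f'), 0) \<in> \<Gamma>" for f f'
        using that by (intro image_eqI [where x = "((f, f'), 0)"]) (auto simp: \<phi>_def \<alpha>_def)
      then show "Range (rel_shift (rel_ker \<Gamma>) z) \<subseteq> \<alpha> ` {x \<in> \<Gamma>. \<phi> x = 0}"
        by (auto simp: rel_shift_def rel_ker_def)
    qed
    then obtain h where h: "\<And>x. x \<in> \<Gamma> \<Longrightarrow> cinner (\<alpha> x) h = \<phi> x"
      by blast
    \<comment> \<open>With \<open>g = J h\<close>, the Krein side of the Green identity is
      \<open>cinner (f' - z *\<^sub>C f) h\<close>, because \<open>J\<close> is an
      involution.\<close>
    have "((J h, cnj z *\<^sub>C J h), (k, k')) \<in> boundary_sharp J \<Gamma>"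
      unfolding boundary_sharp_iff_green
      using h by (force simp: \<alpha>_def \<phi>_def fundamental_symmetry_linear(2) [OF J]
          fundamental_symmetry_involution [OF J] cinner_diff_left cinner_scaleC_left
          cinner_scaleC_right)
    then show ?thesis
      by blast
  qed
  then show "hilbert_adj (weyl_family \<Gamma> z) \<subseteq> weyl_family (boundary_sharp J \<Gamma>) (cnj z)"
    by (auto simp: weyl)
qed

end

theorem corollary4p10:
  fixes J :: "'h::complex_hilbert \<Rightarrow> 'h"
    and T :: "('h \<times> 'h) set"
    and \<Gamma> :: "(('h \<times> 'h) \<times> ('l::complex_hilbert \<times> 'l)) set"
    and z :: complex
  assumes "fundamental_symmetry J"
    and "closed_symmetric_rel J T"
    and "isometric_boundary_pair J T \<Gamma>"
    and "rel_ker (closure \<Gamma>) = T"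
    and "z \<in> Omega_set T \<Gamma>"
    and "defect_number T z < \<infinity>"
    and "defect_number T (cnj z) < \<infinity>"
  shows "hilbert_adj (weyl_family (closure \<Gamma>) z) = weyl_family (boundary_sharp J \<Gamma>) (cnj z)
    \<and> closed_csubspace (weyl_family (closure \<Gamma>) z)"
proof
  note J = assms(1)
  have \<Gamma>: "csubspace \<Gamma>" and T: "rel_ker (boundary_sharp J \<Gamma>) = T"
    using assms(3) by (auto simp: isometric_boundary_pair_def)
  \<comment> \<open>Since \<open>rel_ker (closure \<Gamma>) = T\<close>, membership in
    \<open>Omega_set\<close> controls the ranges of \<open>T\<close> shifted by both
    \<open>z\<close> and \<open>cnj z\<close>.\<close>
  have R: "closed_csubspace (Range (rel_shift T (cnj z)))" "closed_csubspace (Range (rel_shift T z))"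
    using assms(4,5) by (auto simp: Omega_set_def)
  show "hilbert_adj (weyl_family (closure \<Gamma>) z) = weyl_family (boundary_sharp J \<Gamma>) (cnj z)"
    using hilbert_adj_weyl_family [OF J csubspace_closure [OF \<Gamma>], of z] assms(4,6) R
    by (simp add: boundary_sharp_closure [OF J])
  \<comment> \<open>The roles of \<open>z\<close> and \<open>cnj z\<close> are exchanged: this uses
    the closed range and finite defect at \<open>cnj z\<close>, and the double conjugate returns to
    \<open>z\<close>.\<close>
  have "hilbert_adj (weyl_family (boundary_sharp J \<Gamma>) (cnj z)) = weyl_family (closure \<Gamma>) z"
    using hilbert_adj_weyl_family [OF J csubspace_boundary_sharp [OF J], of \<Gamma> "cnj z"] assms(7) R T
    by (simp add: boundary_sharp_sharp [OF J \<Gamma>])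
  then show "closed_csubspace (weyl_family (closure \<Gamma>) z)"
    by (metis closed_csubspace_hilbert_adj)
qed

end
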